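(* Let $k$ be a field of characteristic exponent $p$ and let $f\in k[x]$ be a monic, irreducible polynomial. Let $e$ be the degree of inseparability of $f$, and let $f_{\mathrm{sep}}\in k[x]$ be the separable polynomial with $f(x)=f_{\mathrm{sep}}(x^{p^e})$. Then $$\operatorname{tol}(f)=\operatorname{disc}(f_{\mathrm{sep}})^{p^e}.$$
   Context: Let $\overline{k}$ be an algebraic closure of $k$. For $f=a_nx^n+\ldots+a_0\in k[x]$ with $a_n\neq 0$ and factorization $f=a_n\prod_{i=1}^s(x-r_i)^{m_i}$ over $\overline{k}$, where $r_1,\ldots,r_s$ are distinct and $m_i\geq 1$, the tolerant of $f$ is $\operatorname{tol}(f):=a_n^{2n-2}\prod_{1\leq i<j\leq s}(r_i-r_j)^{2m_im_j}$. A polynomial is separable if it has no repeated roots in $\overline{k}$. The discriminant of a monic polynomial with roots $\rho_1,\ldots,\rho_t$ (listed with multiplicity) is $\prod_{i<j}(\rho_i-\rho_j)^2$. The characteristic exponent of $k$ is $\operatorname{char}k$ if $\operatorname{char}k>0$, and is $1$ if $\operatorname{char}k=0$. The degree of inseparability of $f$ is the minimal exponent $e\geq 0$ such that there exists a separable polynomial $f_{\mathrm{sep}}\in k[x]$ with $f(x)=f_{\mathrm{sep}}(x^{p^e})$. *)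

theory Defs
  imports "HOL-Algebra.Algebraic_Closure_Type"
begin

text \<open>
  Throughout, the base field is the type \<^typ>\<open>'a::field\<close> and its algebraic closure is
  \<^typ>\<open>'a alg_closure\<close>, with embedding \<^const>\<open>to_ac\<close>.  The tolerant and the discriminant
  take values in the algebraic closure.
\<close>

abbreviation over_ac :: "'a::field poly \<Rightarrow> 'a alg_closure poly" where
  "over_ac f \<equiv> map_poly to_ac f"

definition char_exponent :: "'a::field itself \<Rightarrow> nat" where
  "char_exponent _ = (if CHAR('a) = 0 then 1 else CHAR('a))"

text \<open>
  The roots \<open>r\<^sub>1, \<dots>, r\<^sub>s\<close> are given by an arbitrarily chosen enumeration of the root set;
  the multiplicities are the orders of vanishing.  The exponent \<open>2n - 2\<close> is an integer, so it is
  not truncated at \<open>n = 0\<close>.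
\<close>
definition tol :: "'a::field poly \<Rightarrow> 'a alg_closure" where
  "tol f =
    (let F = over_ac f;
         n = Polynomial.degree F;
         rs = (SOME rs. distinct rs \<and> set rs = {r. poly F r = 0})
     in Polynomial.lead_coeff F powi (2 * int n - 2) *
        (\<Prod>j<length rs. \<Prod>i<j.
           (rs ! i - rs ! j) ^ (2 * Polynomial.order (rs ! i) F * Polynomial.order (rs ! j) F)))"

text \<open>
  The discriminant of a \<^emph>\<open>monic\<close> polynomial: there is no factor for the leading coefficient.
  Here the roots are listed with multiplicity.
\<close>
definition disc :: "'a::field poly \<Rightarrow> 'a alg_closure" where
  "disc f =
    (let rs = (SOME rs. mset rs = proots (over_ac f))
     in \<Prod>j<length rs. \<Prod>i<j. (rs ! i - rs ! j) ^ 2)"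

definition separable_poly :: "'a::field poly \<Rightarrow> bool" where
  "separable_poly f \<longleftrightarrow> rsquarefree (over_ac f)"

definition insep_degree :: "'a::field poly \<Rightarrow> nat" where
  "insep_degree f =
    (LEAST e. \<exists>g. separable_poly g \<and> f = pcompose g (Polynomial.monom 1 (char_exponent TYPE('a) ^ e)))"

lemma pair_prod_Cons:
  "(\<Prod>j<length (x # xs). \<Prod>i<j. g ((x # xs) ! i) ((x # xs) ! j)) =
     (\<Prod>y\<in>#mset xs. g x y) * (\<Prod>j<length xs. \<Prod>i<j. g (xs ! i) (xs ! j) :: 'b::comm_monoid_mult)"
proof -
  have "(\<Prod>y\<in>#mset xs. g x y) = (\<Prod>j<length xs. g x (xs ! j))"
    by (induction xs) (simp_all add: prod.lessThan_Suc_shift del: prod.lessThan_Suc)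
  then show ?thesis
    by (simp add: prod.lessThan_Suc_shift prod.distrib del: prod.lessThan_Suc)
qed

lemma pair_prod_move:
  fixes g :: "'a \<Rightarrow> 'a \<Rightarrow> 'b::comm_monoid_mult"
  assumes "\<And>x y. g x y = g y x"
  shows "(\<Prod>j<length (us @ x # vs). \<Prod>i<j. g ((us @ x # vs) ! i) ((us @ x # vs) ! j)) =
     (\<Prod>j<length (x # us @ vs). \<Prod>i<j. g ((x # us @ vs) ! i) ((x # us @ vs) ! j))"
proof (induction us)
  case (Cons u us)
  show ?case
    unfolding append_Cons pair_prod_Cons Cons.IH
    by (simp add: assms[of u x] ac_simps)
qed simp

lemma pair_prod_mset_cong:
  fixes g :: "'a \<Rightarrow> 'a \<Rightarrow> 'b::comm_monoid_mult"
  assumes "\<And>x y. g x y = g y x" and "mset xs = mset ys"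
  shows "(\<Prod>j<length xs. \<Prod>i<j. g (xs ! i) (xs ! j)) = (\<Prod>j<length ys. \<Prod>i<j. g (ys ! i) (ys ! j))"
  using assms(2)
proof (induction xs arbitrary: ys)
  case (Cons x xs)
  have "x \<in> set ys"
    using Cons.prems by (metis list.set_intros(1) set_mset_mset)
  then obtain us vs where ys: "ys = us @ x # vs"
    by (meson split_list)
  with Cons.prems have m: "mset xs = mset (us @ vs)" by simp
  show ?case
    unfolding ys pair_prod_move[where g = g, OF assms(1)] pair_prod_Cons Cons.IH[OF m] m ..
qed simp

text \<open>Neither value depends on the chosen enumeration of the roots.\<close>
lemma tol_eq:
  fixes f :: "'a::field poly"
  defines "F \<equiv> over_ac f"
  assumes "distinct rs" and "set rs = {r. poly F r = 0}"
  shows "tol f = Polynomial.lead_coeff F powi (2 * int (Polynomial.degree F) - 2) *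
    (\<Prod>j<length rs. \<Prod>i<j.
       (rs ! i - rs ! j) ^ (2 * Polynomial.order (rs ! i) F * Polynomial.order (rs ! j) F))"
proof -
  define g where "g x y = (x - y) ^ (2 * Polynomial.order x F * Polynomial.order y F)" for x y
  have sym: "g x y = g y x" for x y
    unfolding g_def mult.assoc power_mult[of _ 2] by (simp add: power2_commute[of x y] mult.commute)
  define rs' where "rs' = (SOME rs. distinct rs \<and> set rs = {r. poly F r = 0})"
  have "distinct rs' \<and> set rs' = {r. poly F r = 0}"
    unfolding rs'_def by (rule someI[of _ rs]) (use assms in auto)
  then have "mset rs' = mset rs"
    using assms set_eq_iff_mset_eq_distinct by metis
  then show ?thesis
    unfolding tol_def Let_def F_def[symmetric] rs'_def[symmetric]
    using pair_prod_mset_cong[of g rs' rs, OF sym] by (simp add: g_def)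
qed

lemma disc_eq:
  assumes "mset rs = proots (over_ac f)"
  shows "disc f = (\<Prod>j<length rs. \<Prod>i<j. (rs ! i - rs ! j) ^ 2)"
proof -
  define rs' where "rs' = (SOME rs. mset rs = proots (over_ac f))"
  have "mset rs' = proots (over_ac f)"
    unfolding rs'_def by (rule someI) (rule assms)
  then show ?thesis
    unfolding disc_def Let_def rs'_def[symmetric]
    using assms pair_prod_mset_cong[of "\<lambda>x y. (x - y) ^ 2" rs' rs] by (simp add: power2_commute)
qed

lemma coeff_pcompose_monom:
  fixes g :: "'a::comm_semiring_1 poly"
  assumes "n > 0"
  shows "Polynomial.coeff (pcompose g (Polynomial.monom 1 n)) i =
    (if n dvd i then Polynomial.coeff g (i div n) else 0)"
proof (induction g arbitrary: i)
  case (pCons a g)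
  show ?case
  proof (cases "i < n")
    case True
    then show ?thesis
      using assms by (cases i) (auto simp: pcompose_pCons coeff_monom_mult coeff_pCons dest: dvd_imp_le split: nat.splits)
  next
    case False
    then have "n dvd i \<longleftrightarrow> n dvd i - n" "i div n = Suc ((i - n) div n)"
      using assms by (auto simp: le_div_geq dvd_minus_self)
    then show ?thesis
      using False assms by (auto simp: pcompose_pCons coeff_monom_mult pCons.IH coeff_pCons split: nat.splits)
  qed
qed simp

lemma pcompose_monom_monom:
  fixes m n :: nat
  assumes "m > 0" "n > 0"
  shows "pcompose (Polynomial.monom 1 m) (Polynomial.monom 1 n) = Polynomial.monom (1::'a::comm_semiring_1) (n * m)"
  by (rule poly_eqI) (use assms in \<open>auto simp: coeff_pcompose_monom; metis dvd_triv_left\<close>)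

lemma over_ac_add: "over_ac (f + g) = over_ac f + over_ac g"
  by (rule poly_eqI) (simp add: coeff_map_poly)

lemma over_ac_mult: "over_ac (f * g) = over_ac f * over_ac g"
  by (rule poly_eqI) (simp add: coeff_map_poly coeff_mult to_ac_sum)

lemma over_ac_pderiv: "over_ac (pderiv f) = pderiv (over_ac f)"
  by (rule poly_eqI) (simp add: coeff_map_poly coeff_pderiv del: of_nat_Suc)

lemma pderiv_eq_0_if_not_separable:
  fixes f :: "'a::field poly"
  assumes irr: "Factorial_Ring.irreducible f" and nsep: "\<not> separable_poly f"
  shows "pderiv f = 0"
proof (rule ccontr)
  assume nz: "pderiv f \<noteq> 0"
  have "f \<noteq> 0" using irr by auto
  then have F0: "over_ac f \<noteq> 0"
    by (simp add: map_poly_eq_0_iff)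
  then obtain r where "Polynomial.order r (over_ac f) \<noteq> 0" "Polynomial.order r (over_ac f) \<noteq> 1"
    using nsep unfolding separable_poly_def rsquarefree_def by blast
  then have "[:- r, 1:] ^ 2 dvd over_ac f"
    using F0 by (subst order_divides) auto
  then obtain q where q: "over_ac f = [:- r, 1:] * ([:- r, 1:] * q)"
    unfolding power2_eq_square mult.assoc by (rule dvdE) (simp only: mult.assoc)
  have r: "poly (over_ac f) r = 0" "poly (over_ac (pderiv f)) r = 0"
    unfolding over_ac_pderiv unfolding q pderiv_mult by simp_all
  define P where "P g \<longleftrightarrow> g \<noteq> 0 \<and> poly (over_ac g) r = 0" for g
  define g where "g = arg_min Polynomial.degree P"
  have "P f" using \<open>f \<noteq> 0\<close> r by (simp add: P_def)
  then have g: "P g" and min: "\<And>h. P h \<Longrightarrow> Polynomial.degree g \<le> Polynomial.degree h"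
    unfolding g_def using arg_min_nat_lemma[of P f] by auto
  have dvd: "g dvd h" if "poly (over_ac h) r = 0" for h
  proof (rule ccontr)
    assume n: "\<not> g dvd h"
    have "poly (over_ac (h div g * g + h mod g)) r = 0"
      using that by simp
    then have "poly (over_ac (h mod g)) r = 0"
      using g unfolding over_ac_add over_ac_mult P_def by simp
    moreover have "h mod g \<noteq> 0" using n by (simp add: dvd_eq_mod_eq_0)
    ultimately have "Polynomial.degree g \<le> Polynomial.degree (h mod g)"
      by (intro min) (simp add: P_def)
    then show False
      using degree_mod_less'[of g h] g \<open>h mod g \<noteq> 0\<close> by (auto simp: P_def)
  qed
  have "\<not> is_unit g"
    using g by (auto simp: P_def is_unit_poly_iff map_poly_pCons)
  obtain c where c: "f = g * c" using dvd[OF r(1)] by blast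
  then have "is_unit c"
    using irr \<open>\<not> is_unit g\<close> by (meson irreducibleD)
  then have "Polynomial.degree f = Polynomial.degree g"
    using \<open>f \<noteq> 0\<close> c by (auto simp: is_unit_poly_iff)
  also have "\<dots> \<le> Polynomial.degree (pderiv f)"
    using dvd[OF r(2)] nz by (rule dvd_imp_degree_le)
  also have "\<dots> \<le> Polynomial.degree f - 1"
    by (rule degree_le) (auto simp: coeff_pderiv coeff_eq_0)
  finally have "Polynomial.degree f = 0" by simp
  then show False using nz by (auto elim!: degree_eq_zeroE simp: pderiv_pCons)
qed

lemma ex_separable_decomposition:
  fixes f :: "'a::field poly"
  assumes "Factorial_Ring.irreducible f"
  shows "\<exists>e g. separable_poly g \<and> f = pcompose g (Polynomial.monom 1 (char_exponent TYPE('a) ^ e))"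
  using assms
proof (induction "Polynomial.degree f" arbitrary: f rule: less_induct)
  case less
  let ?p = "CHAR('a)"
  have f0: "f \<noteq> 0" using less.prems by auto
  then have deg: "Polynomial.degree f \<noteq> 0"
    using irreducible_not_unit[OF less.prems] by (simp add: is_unit_iff_degree)
  show ?case
  proof (cases "separable_poly f")
    case True
    then show ?thesis by (intro exI[of _ 0] exI[of _ f]) (simp add: monom_altdef)
  next
    case False
    then have pd: "pderiv f = 0"
      using less.prems pderiv_eq_0_if_not_separable by blast
    have co: "?p dvd i" if "Polynomial.coeff f i \<noteq> 0" for i
    proof (cases i)
      case (Suc j)
      have "of_nat i * Polynomial.coeff f i = (0 :: 'a)"
        using arg_cong[OF pd, of "\<lambda>q. Polynomial.coeff q j"] Suc by (simp add: coeff_pderiv)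
      then show ?thesis using that of_nat_eq_0_iff_char_dvd[of i, where ?'a = 'a] by simp
    qed simp
    have p0: "?p \<noteq> 0"
      using co[of "Polynomial.degree f"] f0 deg by auto
    then have p: "prime ?p" using prime_CHAR_semidom by auto
    define g where "g = Abs_poly (\<lambda>i. Polynomial.coeff f (?p * i))"
    have cg: "Polynomial.coeff g i = Polynomial.coeff f (?p * i)" for i
    proof -
      have "\<forall>i>Polynomial.degree f. Polynomial.coeff f (?p * i) = 0"
        using p0 by (intro allI impI coeff_eq_0) (metis less_le_trans mult_le_mono1 nat_mult_1 One_nat_def Suc_leI neq0_conv)
      then show ?thesis unfolding g_def by (subst coeff_Abs_poly) auto
    qed
    have fg: "f = pcompose g (Polynomial.monom 1 ?p)"
      by (rule poly_eqI) (use p0 co in \<open>auto simp: coeff_pcompose_monom cg\<close>)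
    have dg: "Polynomial.degree (pcompose h (Polynomial.monom 1 ?p)) = Polynomial.degree h * ?p" for h :: "'a poly"
      by (simp add: degree_pcompose degree_monom_eq)
    have "Factorial_Ring.irreducible g"
    proof (rule irreducibleI)
      show "g \<noteq> 0" using f0 fg by auto
      show "\<not> is_unit g" using deg dg[of g] fg by (auto simp: is_unit_poly_iff)
      fix a b assume ab: "g = a * b"
      have "f = pcompose a (Polynomial.monom 1 ?p) * pcompose b (Polynomial.monom 1 ?p)"
        using fg ab by (simp add: pcompose_mult)
      with less.prems have "is_unit (pcompose a (Polynomial.monom 1 ?p)) \<or> is_unit (pcompose b (Polynomial.monom 1 ?p))"
        by (rule irreducibleD)
      moreover have "is_unit h"
        if "is_unit (pcompose h (Polynomial.monom 1 ?p))" "h \<noteq> 0" for h :: "'a poly"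
        using that p0 dg[of h] by (auto simp: is_unit_iff_degree[of h] is_unit_poly_iff[of "pcompose h _"])
      ultimately show "is_unit a \<or> is_unit b"
        using \<open>g \<noteq> 0\<close> ab by auto
    qed
    moreover have "Polynomial.degree g < Polynomial.degree f"
      using deg dg[of g] fg p prime_gt_1_nat by auto
    ultimately obtain e h where eh: "separable_poly h"
        "g = pcompose h (Polynomial.monom 1 (char_exponent TYPE('a) ^ e))"
      using less.hyps by blast
    have "f = pcompose h (Polynomial.monom 1 (char_exponent TYPE('a) ^ Suc e))"
      using p0 unfolding fg eh(2)
      by (simp add: pcompose_assoc[symmetric] pcompose_monom_monom char_exponent_def)
    with eh show ?thesis by blast
  qed
qed

text \<open>
  For irreducible \<open>f\<close> the set of exponents in \<^const>\<open>insep_degree\<close> is therefore nonempty, and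
  the polynomial \<open>f\<^sub>s\<^sub>e\<^sub>p\<close> exists and is unique.
\<close>
lemma ex1_separable_part:
  fixes f :: "'a::field poly"
  assumes "Factorial_Ring.irreducible f"
  shows "\<exists>!g. separable_poly g \<and>
    f = pcompose g (Polynomial.monom 1 (char_exponent TYPE('a) ^ insep_degree f))"
proof (rule ex_ex1I)
  show "\<exists>g. separable_poly g \<and>
    f = pcompose g (Polynomial.monom 1 (char_exponent TYPE('a) ^ insep_degree f))"
    unfolding insep_degree_def by (rule LeastI_ex) (rule ex_separable_decomposition[OF assms])
next
  fix g h :: "'a poly"
  let ?q = "char_exponent TYPE('a) ^ insep_degree f"
  assume "separable_poly g \<and> f = pcompose g (Polynomial.monom 1 ?q)"
    and "separable_poly h \<and> f = pcompose h (Polynomial.monom 1 ?q)"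
  then have eq: "pcompose g (Polynomial.monom 1 ?q) = pcompose h (Polynomial.monom 1 ?q)" by metis
  have "?q > 0" by (simp add: char_exponent_def)
  then show "g = h"
    using arg_cong[OF eq, of "\<lambda>r. Polynomial.coeff r (?q * i)" for i]
    by (intro poly_eqI) (simp add: coeff_pcompose_monom)
qed

end

theory Submission
  imports Defs
begin

text \<open>
  Put \<open>q = p ^ e\<close>. Since \<open>q\<close> is a power of the characteristic exponent, \<open>x \<mapsto> x ^ q\<close> is an
  injective ring endomorphism, and over the algebraic closure it is bijective. Every root \<open>a\<close> of
  \<open>f\<^sub>s\<^sub>e\<^sub>p\<close> therefore has exactly one \<open>q\<close>-th root \<open>b\<close>, and \<open>x ^ q - a = (x - b) ^ q\<close>.
  Hence the roots of \<open>f\<close> are these \<open>b\<close>, and each has multiplicity \<open>q\<close> because \<open>f\<^sub>s\<^sub>e\<^sub>p\<close> has simple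
  roots (lemma \<open>order_pcompose_frobenius\<close>). So two distinct roots \<open>b\<^sub>i\<close>, \<open>b\<^sub>j\<close> contribute to the
  tolerant the factor
  \<open>(b\<^sub>i - b\<^sub>j) ^ (2 * q * q) = ((b\<^sub>i ^ q - b\<^sub>j ^ q) ^ 2) ^ q = ((a\<^sub>i - a\<^sub>j) ^ 2) ^ q\<close>,
  which is the \<open>q\<close>-th power of the factor contributed to the discriminant by \<open>a\<^sub>i\<close>, \<open>a\<^sub>j\<close>. The
  leading coefficient contributes nothing, as \<open>f\<close> is monic.
\<close>

lemma diff_power_char_exponent:
  fixes x y :: "'b::idom"
  assumes "q = (if CHAR('b) = 0 then 1 else CHAR('b)) ^ e"
  shows "(x - y) ^ q = x ^ q - y ^ q"
proof (cases "CHAR('b) = 0")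
  case True
  then show ?thesis using assms by simp
next
  case False
  then have "prime CHAR('b)" using prime_CHAR_semidom by auto
  from freshmans_dream'[OF this, of q e "x - y" y] show ?thesis
    using assms False by (simp add: algebra_simps)
qed

lemma pcompose_power:
  fixes g h :: "'b::comm_semiring_1 poly"
  shows "pcompose (g ^ n) h = pcompose g h ^ n"
  by (induction n) (simp_all add: pcompose_mult one_pCons)

text \<open>
  Split off the root \<open>b ^ q\<close> as \<open>G = (x - b ^ q) ^ m * H\<close> with \<open>H\<close> nonzero at \<open>b ^ q\<close>. Substituting
  \<open>x ^ q\<close> turns the first factor into \<open>(x - b) ^ (q * m)\<close>, by the Frobenius identity in the
  polynomial ring, and leaves the second one nonzero at \<open>b\<close>.
\<close>
lemma order_pcompose_frobenius:
  fixes G :: "'b::field poly"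
  assumes q: "q = (if CHAR('b) = 0 then 1 else CHAR('b)) ^ e" and "G \<noteq> 0"
  shows "Polynomial.order b (pcompose G (Polynomial.monom 1 q)) = q * Polynomial.order (b ^ q) G"
proof -
  let ?m = "Polynomial.order (b ^ q) G" and ?X = "Polynomial.monom 1 q :: 'b poly"
  obtain H where G: "G = [:- (b ^ q), 1:] ^ ?m * H" and H: "\<not> [:- (b ^ q), 1:] dvd H"
    using order_decomp[OF \<open>G \<noteq> 0\<close>] by blast
  have "[:- b, 1:] ^ q = (Polynomial.monom 1 1 - [:b:]) ^ q"
    by (simp add: monom_altdef)
  also have "\<dots> = ?X - [:b ^ q:]"
    using q by (simp add: diff_power_char_exponent[where e = e] monom_power poly_const_pow)
  also have "\<dots> = pcompose [:- (b ^ q), 1:] ?X"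
    by (simp add: pcompose_pCons)
  finally have lin: "pcompose [:- (b ^ q), 1:] ?X = [:- b, 1:] ^ q" by simp
  have "pcompose G ?X = pcompose ([:- (b ^ q), 1:] ^ ?m * H) ?X"
    using G by simp
  also have "\<dots> = pcompose [:- (b ^ q), 1:] ?X ^ ?m * pcompose H ?X"
    by (simp only: pcompose_mult pcompose_power)
  also have "\<dots> = [:- b, 1:] ^ (q * ?m) * pcompose H ?X"
    by (simp only: lin power_mult)
  finally have eq: "pcompose G ?X = [:- b, 1:] ^ (q * ?m) * pcompose H ?X" .
  have "\<not> [:- b, 1:] dvd pcompose H ?X"
    using H by (simp add: poly_eq_0_iff_dvd[symmetric] poly_pcompose poly_monom)
  then show ?thesis
    unfolding eq
    by (intro order_unique_lemma) (simp_all only: power_Suc2 dvd_triv_left dvd_mult_cancel_left, simp)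
qed

lemma over_ac_pcompose_monom:
  assumes "n > 0"
  shows "over_ac (pcompose g (Polynomial.monom 1 n)) = pcompose (over_ac g) (Polynomial.monom 1 n)"
  by (rule poly_eqI) (simp add: coeff_map_poly coeff_pcompose_monom[OF assms])

theorem corollary2p8:
  fixes f f_sep :: "'a::field poly" and p e :: nat
  assumes "p = char_exponent TYPE('a)"
    and "Polynomial.lead_coeff f = 1" and "Factorial_Ring.irreducible f"
    and "e = insep_degree f"
    and "separable_poly f_sep" and "f = pcompose f_sep (Polynomial.monom 1 (p ^ e))"
  shows "tol f = disc f_sep ^ (p ^ e)"
proof -
  define q where "q = p ^ e"
  define F G where "F = over_ac f" and "G = over_ac f_sep"
  have q: "q = (if CHAR('a alg_closure) = 0 then 1 else CHAR('a alg_closure)) ^ e"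
    using assms(1) by (simp add: q_def char_exponent_def)
  then have q0: "q > 0" by simp
  have FG: "F = pcompose G (Polynomial.monom 1 q)"
    unfolding F_def G_def assms(6) using over_ac_pcompose_monom[OF q0] by (simp add: q_def)
  have G: "rsquarefree G" "G \<noteq> 0"
    using assms(5) by (simp_all add: separable_poly_def G_def rsquarefree_def)
  have frob: "(x - y) ^ q = x ^ q - y ^ q" for x y :: "'a alg_closure"
    using q by (rule diff_power_char_exponent)
  have ord: "Polynomial.order b F = q" if "poly G (b ^ q) = 0" for b
    using order_pcompose_frobenius[OF q G(2), of b] rsquarefree_root_order[OF G(1) that G(2)]
    by (simp add: FG)
  have "\<exists>b. b ^ q = a" for a :: "'a alg_closure"
    using nth_root_exists[OF q0, of a] by blast
  then obtain rt where rt: "rt a ^ q = a" for a :: "'a alg_closure"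
    by metis
  have rt_power: "rt (b ^ q) = b" for b
    using frob[of "rt (b ^ q)" b] q0 by (simp add: rt)
  obtain as where as: "mset as = proots G"
    using ex_mset by blast
  have set_as: "set as = {a. poly G a = 0}"
    using arg_cong[OF as, of set_mset] G(2) by simp
  have "count (mset as) a = (if a \<in> set as then 1 else 0)" for a
    using rsquarefree_root_order[OF G(1) _ G(2), of a] G(2) set_as
    by (auto simp: as order_root)
  then have "distinct as"
    by (simp add: distinct_count_atmost_1)
  define bs where "bs = map rt as"
  have "inj_on rt (set as)" by (metis rt inj_onI)
  then have "distinct bs"
    using \<open>distinct as\<close> by (simp add: bs_def distinct_map)
  have "set bs = {b. poly F b = 0}"
  proof -
    have "poly F b = 0 \<longleftrightarrow> b ^ q \<in> set as" for b
      by (simp add: FG poly_pcompose poly_monom set_as)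
    moreover have "b ^ q \<in> set as \<longleftrightarrow> b \<in> rt ` set as" for b
      by (metis imageE image_eqI rt rt_power)
    ultimately show ?thesis by (auto simp: bs_def)
  qed
  have factor: "(bs ! i - bs ! j) ^ (2 * Polynomial.order (bs ! i) F * Polynomial.order (bs ! j) F)
      = ((as ! i - as ! j) ^ 2) ^ q" if ij: "i < length as" "j < length as" for i j
  proof -
    have "poly G (as ! i) = 0" "poly G (as ! j) = 0"
      using ij set_as nth_mem by blast+
    with ij have "Polynomial.order (bs ! i) F = q" "Polynomial.order (bs ! j) F = q"
      by (simp_all add: bs_def ord rt)
    then have "(bs ! i - bs ! j) ^ (2 * Polynomial.order (bs ! i) F * Polynomial.order (bs ! j) F)
        = (((bs ! i - bs ! j) ^ q) ^ 2) ^ q"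
      by (simp add: power_mult[symmetric] ac_simps)
    also have "\<dots> = ((as ! i - as ! j) ^ 2) ^ q"
      using ij by (simp add: frob bs_def rt)
    finally show ?thesis .
  qed
  have "Polynomial.lead_coeff F = 1"
    using assms(2) by (simp add: F_def coeff_map_poly degree_map_poly)
  then have "tol f = (\<Prod>j<length bs. \<Prod>i<j.
      (bs ! i - bs ! j) ^ (2 * Polynomial.order (bs ! i) F * Polynomial.order (bs ! j) F))"
    using tol_eq[of bs f] \<open>distinct bs\<close> \<open>set bs = _\<close> by (simp add: F_def)
  also have "\<dots> = (\<Prod>j<length as. \<Prod>i<j. ((as ! i - as ! j) ^ 2) ^ q)"
    by (intro prod.cong factor) (auto simp: bs_def)
  also have "\<dots> = disc f_sep ^ q"
    using as by (simp add: disc_eq[of as f_sep] G_def prod_power_distrib)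
  finally show ?thesis by (simp add: q_def)
qed

end
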